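(* For any $q\ge 1$, the set of minimal monomial generators of the second symbolic power $\mathcal{E}_q^{(2)}$ of the $q$-extremal ideal is $$\mathrm{Mingens}\big(\mathcal{E}_q^{(2)}\big)=\{f_X : \emptyset\neq X\subseteq[q]\}.$$
   Context: Let $\mathsf{k}$ be a field, $[q]=\{1,\dots,q\}$, and $S_{[q]}=\mathsf{k}[y_A : \emptyset\neq A\subseteq[q]]$. For $i\in[q]$ set $\epsilon_i=\prod_{A\subseteq[q],\, i\in A}y_A$. The $q$-extremal ideal is $\mathcal{E}_q=(\epsilon_1,\dots,\epsilon_q)\subseteq S_{[q]}$. For $\emptyset\neq X\subseteq[q]$: $$f_X=\prod_{X\subseteq A}y_A^2\ \prod_{X\cap A\neq\emptyset,\ X\cap A^{c}\neq\emptyset}y_A,$$ where $A$ ranges over nonempty subsets of $[q]$ and $A^c=[q]\smallsetminus A$. For a square-free monomial ideal $J$, $J^{(r)}=\bigcap_{P\in\mathrm{Min}(J)}P^r$, where $\mathrm{Min}(J)$ is the set of minimal primes of $J$. $\mathrm{Mingens}(J)$ denotes the set of minimal monomial generators of a monomial ideal $J$. *)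

theory Defs
  imports "HOL-Library.Poly_Mapping" "HOL-Algebra.Ideal_Product"
begin

subsection \<open>Polynomial rings over a field\<close>

text \<open>
  A polynomial over \<open>'k\<close> with indeterminates in \<open>'v\<close> is a finitely supported map from
  exponent vectors \<open>'v \<Rightarrow>\<^sub>0 nat\<close> to \<open>'k\<close>; the multiplication of \<open>poly_mapping\<close> is the
  convolution product. The carrier below consists of the polynomials in which only
  indeterminates from \<open>V\<close> occur.
\<close>

type_synonym ('v, 'k) mpoly = "('v \<Rightarrow>\<^sub>0 nat) \<Rightarrow>\<^sub>0 'k"

definition poly_ring :: "'v set \<Rightarrow> ('v, 'k::field) mpoly ring" where
  "poly_ring V =
     \<lparr>carrier = {p. \<forall>m\<in>Poly_Mapping.keys p. Poly_Mapping.keys m \<subseteq> V},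
      mult = (*), one = 1, zero = 0, add = (+)\<rparr>"

definition indet :: "'v \<Rightarrow> ('v, 'k::field) mpoly" where
  "indet v = Poly_Mapping.single (Poly_Mapping.single v 1) 1"

definition monomials :: "'v set \<Rightarrow> ('v, 'k::field) mpoly set" where
  "monomials V = {Poly_Mapping.single m 1 |m. Poly_Mapping.keys m \<subseteq> V}"

lemma poly_ring_sel [simp]:
  "carrier (poly_ring V) = {p. \<forall>m\<in>Poly_Mapping.keys p. Poly_Mapping.keys m \<subseteq> V}"
  "mult (poly_ring V) = (*)" "one (poly_ring V) = 1"
  "zero (poly_ring V) = 0" "add (poly_ring V) = (+)"
  by (simp_all add: poly_ring_def)

lemma cring_poly_ring: "cring (poly_ring V :: ('v, 'k::field) mpoly ring)"
proof (rule cringI)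
  show "abelian_group (poly_ring V :: ('v, 'k) mpoly ring)"
  proof (rule abelian_groupI)
    fix p q :: "('v, 'k) mpoly"
    assume "p \<in> carrier (poly_ring V)" "q \<in> carrier (poly_ring V)"
    then show "p \<oplus>\<^bsub>poly_ring V\<^esub> q \<in> carrier (poly_ring V)"
      using Poly_Mapping.keys_add[of p q] by auto
  next
    fix p :: "('v, 'k) mpoly"
    assume "p \<in> carrier (poly_ring V)"
    then show "\<exists>q\<in>carrier (poly_ring V). q \<oplus>\<^bsub>poly_ring V\<^esub> p = \<zero>\<^bsub>poly_ring V\<^esub>"
      by (intro bexI[of _ "- p"]) (auto simp: keys_minus)
  qed (simp_all add: add_ac)
  show "Group.comm_monoid (poly_ring V :: ('v, 'k) mpoly ring)"
  proof (rule comm_monoidI)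
    fix p q :: "('v, 'k) mpoly"
    assume *: "p \<in> carrier (poly_ring V)" "q \<in> carrier (poly_ring V)"
    have "Poly_Mapping.keys m \<subseteq> V" if "m \<in> Poly_Mapping.keys (p * q)" for m
    proof -
      from that obtain a b where "a \<in> Poly_Mapping.keys p" "b \<in> Poly_Mapping.keys q" "m = a + b"
        using Poly_Mapping.keys_mult[of p q] by blast
      with * Poly_Mapping.keys_add[of a b] show ?thesis by fastforce
    qed
    then show "p \<otimes>\<^bsub>poly_ring V\<^esub> q \<in> carrier (poly_ring V)" by auto
  qed (simp_all add: mult_ac)
qed (simp add: distrib_right)


subsection \<open>Minimal primes, symbolic powers, minimal monomial generators\<close>

definition minimal_primes :: "('a, 'b) ring_scheme \<Rightarrow> 'a set \<Rightarrow> 'a set set" where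
  "minimal_primes R J =
     {P. primeideal P R \<and> J \<subseteq> P \<and> (\<forall>Q. primeideal Q R \<and> J \<subseteq> Q \<and> Q \<subseteq> P \<longrightarrow> Q = P)}"

text \<open>
  \<open>P [^]\<^bsub>ideals_set R\<^esub> r\<close> is the \<open>r\<close>-fold ideal product of \<open>P\<close>. Intersecting with the carrier
  only matters if \<open>J\<close> has no minimal primes, that is, if \<open>J\<close> is the unit ideal. For
  square-free monomial \<open>J\<close> this is the usual symbolic power; for arbitrary ideals it need not be.
\<close>

definition symbolic_power :: "('a, 'b) ring_scheme \<Rightarrow> 'a set \<Rightarrow> nat \<Rightarrow> 'a set" where
  "symbolic_power R J r = carrier R \<inter> (\<Inter>P\<in>minimal_primes R J. P [^]\<^bsub>ideals_set R\<^esub> r)"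

text \<open>
  The minimal monomial generators are the inclusion-minimal generating set consisting of monomials
  with coefficient 1. There is at most one such set (\<open>Mingens_eqI\<close> below); \<open>Mingens V J\<close> is
  only meaningful if \<open>J\<close> is generated by monomials.
\<close>

definition is_Mingens :: "'v set \<Rightarrow> ('v, 'k::field) mpoly set \<Rightarrow> ('v, 'k) mpoly set \<Rightarrow> bool" where
  "is_Mingens V J G \<longleftrightarrow>
     G \<subseteq> monomials V \<and> Idl\<^bsub>poly_ring V\<^esub> G = J \<and> (\<forall>H. H \<subset> G \<longrightarrow> Idl\<^bsub>poly_ring V\<^esub> H \<noteq> J)"

definition Mingens :: "'v set \<Rightarrow> ('v, 'k::field) mpoly set \<Rightarrow> ('v, 'k) mpoly set" where
  "Mingens V J = (THE G. is_Mingens V J G)"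

lemma monomials_carrier: "monomials V \<subseteq> carrier (poly_ring V)"
  by (auto simp: monomials_def)

lemma monomial_in_Idl:
  fixes H :: "('v, 'k::field) mpoly set"
  assumes H: "H \<subseteq> monomials V" and m: "Poly_Mapping.single m 1 \<in> Idl\<^bsub>poly_ring V\<^esub> H"
  shows "\<exists>h k. Poly_Mapping.single h 1 \<in> H \<and> m = h + k"
proof -
  interpret cring "poly_ring V :: ('v, 'k) mpoly ring" by (rule cring_poly_ring)
  define I :: "('v, 'k) mpoly set" where "I = {p \<in> carrier (poly_ring V). \<forall>m\<in>Poly_Mapping.keys p.
                         \<exists>h k. Poly_Mapping.single h (1::'k) \<in> H \<and> m = h + k}"
  have mult: "a * x \<in> I" if a: "a \<in> I" and x: "x \<in> carrier (poly_ring V)" for a x :: "('v, 'k) mpoly"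
  proof -
    have "a * x \<in> carrier (poly_ring V)"
      using m_closed[of a x] a x by (simp add: I_def)
    moreover have "\<exists>h k. Poly_Mapping.single h (1::'k) \<in> H \<and> n = h + k"
      if "n \<in> Poly_Mapping.keys (a * x)" for n
    proof -
      from that obtain b c where b: "b \<in> Poly_Mapping.keys a" and n: "n = b + c"
        using Poly_Mapping.keys_mult[of a x] by blast
      from a b obtain h k where "Poly_Mapping.single h (1::'k) \<in> H" "b = h + k"
        unfolding I_def by blast
      with n show ?thesis by (metis add.assoc)
    qed
    ultimately show ?thesis unfolding I_def by blast
  qed
  have "ideal I (poly_ring V)"
  proof (rule idealI)
    show "subgroup I (add_monoid (poly_ring V))"
    proof (rule add.subgroupI)
      show "I \<subseteq> carrier (poly_ring V)" by (auto simp: I_def)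
      have "0 \<in> I" by (simp add: I_def)
      then show "I \<noteq> {}" by blast
    next
      fix a assume a: "a \<in> I"
      have "(-1 :: ('v, 'k) mpoly) \<in> carrier (poly_ring V)"
        by (auto simp: keys_minus simp flip: single_one)
      from mult[OF a this] have na: "- a \<in> I" by simp
      have "\<ominus>\<^bsub>poly_ring V\<^esub> a = - a"
        using a na by (intro minus_equality) (auto simp: I_def)
      with na show "\<ominus>\<^bsub>poly_ring V\<^esub> a \<in> I" by simp
    next
      fix a b assume ab: "a \<in> I" "b \<in> I"
      then have "a + b \<in> carrier (poly_ring V)"
        using a_closed[of a b] by (simp add: I_def)
      with ab Poly_Mapping.keys_add[of a b] show "a \<oplus>\<^bsub>poly_ring V\<^esub> b \<in> I"
        unfolding I_def poly_ring_sel by blast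
    qed
  next
    fix a x :: "('v, 'k) mpoly" assume *: "a \<in> I" "x \<in> carrier (poly_ring V)"
    show "a \<otimes>\<^bsub>poly_ring V\<^esub> x \<in> I" using mult[OF *] by simp
    show "x \<otimes>\<^bsub>poly_ring V\<^esub> a \<in> I" using mult[OF *] by (simp add: mult.commute)
  qed (rule ring_axioms)
  moreover have "H \<subseteq> I"
  proof
    fix p assume p: "p \<in> H"
    with H obtain n where n: "p = Poly_Mapping.single n 1" by (auto simp: monomials_def)
    have "Poly_Mapping.single n 1 \<in> H \<and> n = n + 0" using p n by simp
    with p n H monomials_carrier[of V] show "p \<in> I" unfolding I_def by fastforce
  qed
  ultimately have "Poly_Mapping.single m 1 \<in> I" using m genideal_minimal by blast
  then show ?thesis by (simp add: I_def)
qed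

lemma is_Mingens_subset:
  fixes G :: "('v, 'k::field) mpoly set"
  assumes G: "is_Mingens V J G" and H: "is_Mingens V J H"
  shows "G \<subseteq> H"
proof
  interpret cring "poly_ring V :: ('v, 'k) mpoly ring" by (rule cring_poly_ring)
  have Gm: "G \<subseteq> monomials V" "H \<subseteq> monomials V"
    and GJ: "Idl\<^bsub>poly_ring V\<^esub> G = J" "Idl\<^bsub>poly_ring V\<^esub> H = J"
    using G H by (simp_all add: is_Mingens_def)
  have Gc: "G \<subseteq> carrier (poly_ring V)" "H \<subseteq> carrier (poly_ring V)"
    using Gm[THEN subset_trans, OF monomials_carrier] by this
  have sub: "G \<subseteq> J" "H \<subseteq> J"
    using genideal_self[OF Gc(1)] genideal_self[OF Gc(2)] GJ by simp_all
  fix p assume p: "p \<in> G"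
  then obtain g where g: "p = Poly_Mapping.single g 1" "Poly_Mapping.keys g \<subseteq> V"
    using Gm(1) unfolding monomials_def by blast
  have "Poly_Mapping.single g 1 \<in> Idl\<^bsub>poly_ring V\<^esub> H"
    using subsetD[OF sub(1) p] GJ g by simp
  from monomial_in_Idl[OF Gm(2) this]
  obtain h k where h: "Poly_Mapping.single h 1 \<in> H" "g = h + k" by blast
  have "Poly_Mapping.single h 1 \<in> Idl\<^bsub>poly_ring V\<^esub> G"
    using subsetD[OF sub(2) h(1)] GJ by simp
  from monomial_in_Idl[OF Gm(1) this]
  obtain g' k' where g': "Poly_Mapping.single g' 1 \<in> G" "h = g' + k'" by blast
  show "p \<in> H"
  proof (cases "g' = g")
    case True
    have "g' + (k' + k) = g' + 0" using True g'(2) h(2) by (metis add.assoc add.right_neutral)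
    then have "k' + k = 0" by (rule add_left_imp_eq)
    then have "\<And>v. Poly_Mapping.lookup k v = 0"
      by (metis add_is_0 lookup_add lookup_zero)
    then have "k = 0" by (simp add: poly_mapping_eqI)
    with h g show ?thesis by simp
  next
    case False
    define G' where "G' = G - {p}"
    have "Poly_Mapping.single g' (1::'k) \<noteq> p"
    proof
      assume "Poly_Mapping.single g' (1::'k) = p"
      then have "Poly_Mapping.keys (Poly_Mapping.single g' (1::'k)) =
                 Poly_Mapping.keys (Poly_Mapping.single g (1::'k))" using g(1) by simp
      then show False using False by simp
    qed
    then have ps: "Poly_Mapping.single g' 1 \<in> G'" using g'(1) by (simp add: G'_def)
    have G'c: "G' \<subseteq> carrier (poly_ring V)" using Gc by (auto simp: G'_def)
    interpret I: ideal "Idl\<^bsub>poly_ring V\<^esub> G'" "poly_ring V" by (rule genideal_ideal[OF G'c])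
    have e: "g = g' + (k' + k)" using g' h by (simp add: add.assoc)
    have "Poly_Mapping.keys (k' + k) \<subseteq> Poly_Mapping.keys g"
      unfolding e by (auto simp: in_keys_iff lookup_add)
    then have "Poly_Mapping.single (k' + k) (1::'k) \<in> carrier (poly_ring V)"
      using g by auto
    from I.I_r_closed[OF subsetD[OF genideal_self[OF G'c] ps] this]
    have "p \<in> Idl\<^bsub>poly_ring V\<^esub> G'" by (simp add: mult_single g(1) e)
    then have "G \<subseteq> Idl\<^bsub>poly_ring V\<^esub> G'" using genideal_self[OF G'c] by (auto simp: G'_def)
    then have "Idl\<^bsub>poly_ring V\<^esub> G \<subseteq> Idl\<^bsub>poly_ring V\<^esub> G'"
      by (intro genideal_minimal I.ideal_axioms)
    moreover have "Idl\<^bsub>poly_ring V\<^esub> G' \<subseteq> Idl\<^bsub>poly_ring V\<^esub> G"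
      using genideal_self[OF Gc(1)] by (intro genideal_minimal genideal_ideal Gc) (auto simp: G'_def)
    ultimately have "Idl\<^bsub>poly_ring V\<^esub> G' = J" using G by (auto simp: is_Mingens_def)
    moreover have "G' \<subset> G" using p by (auto simp: G'_def)
    ultimately show ?thesis using G by (auto simp: is_Mingens_def)
  qed
qed

lemma Mingens_eqI:
  assumes "is_Mingens V J G"
  shows "Mingens V J = G"
  unfolding Mingens_def
proof (rule the_equality)
  fix H assume "is_Mingens V J H"
  then show "H = G" using assms is_Mingens_subset by (metis subset_antisym)
qed (rule assms)


subsection \<open>Extremal ideals\<close>

text \<open>The indeterminates \<open>y\<^sub>A\<close> are indexed by the nonempty subsets \<open>A\<close> of \<open>[q] = {1..q}\<close>.\<close>

definition ext_vars :: "nat \<Rightarrow> nat set set" where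
  "ext_vars q = {A. A \<noteq> {} \<and> A \<subseteq> {1..q}}"

definition ext_ring :: "nat \<Rightarrow> (nat set, 'k::field) mpoly ring" where
  "ext_ring q = poly_ring (ext_vars q)"

definition ext_gen :: "nat \<Rightarrow> nat \<Rightarrow> (nat set, 'k::field) mpoly" where
  "ext_gen q i = (\<Prod>A\<in>{A \<in> ext_vars q. i \<in> A}. indet A)"

definition extremal_ideal :: "nat \<Rightarrow> (nat set, 'k::field) mpoly set" where
  "extremal_ideal q = Idl\<^bsub>ext_ring q\<^esub> (ext_gen q ` {1..q})"

definition f_gen :: "nat \<Rightarrow> nat set \<Rightarrow> (nat set, 'k::field) mpoly" where
  "f_gen q X =
     (\<Prod>A\<in>{A \<in> ext_vars q. X \<subseteq> A}. indet A ^ 2) *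
     (\<Prod>A\<in>{A \<in> ext_vars q. X \<inter> A \<noteq> {} \<and> X \<inter> ({1..q} - A) \<noteq> {}}. indet A)"

end

theory Submission
  imports Defs
begin

text \<open>
  A prime containing the extremal ideal contains, for each \<open>i \<in> [q]\<close>, some \<open>y\<^sub>A\<close> with
  \<open>i \<in> A\<close>; the sets \<open>A\<close> so obtained cover \<open>[q]\<close>. Conversely, the indeterminates of a cover
  generate a prime ideal containing the extremal ideal. So the minimal primes correspond to
  the minimal covers \<open>C\<close>, and a polynomial lies in the square of the prime of \<open>C\<close> iff each of
  its monomials has degree at least 2 in the indeterminates from \<open>C\<close>. Hence the symbolic square
  is spanned by the monomials \<open>m\<close> that have degree at least 2 on every cover
  (\<open>symbolic_square_extremal_ideal\<close>).

  Each \<open>f\<^sub>X\<close> satisfies this: a cover either has a member containing \<open>X\<close>, with exponent 2, or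
  needs two members to cover \<open>X\<close>, each with exponent 1 (\<open>f_exp_deg_on_cover\<close>). For the converse,
  given \<open>m\<close>, let \<open>Z\<close> be the set of those \<open>A\<close> for which \<open>y\<^sub>A\<close> does not occur in \<open>m\<close>. It is not
  a cover, as \<open>m\<close> has degree 0 on it, so \<open>X = [q] - \<Union>Z\<close> is nonempty, and \<open>f\<^sub>X\<close> divides \<open>m\<close>
  (\<open>f_exp_divides\<close>). Finally no \<open>f\<^sub>X\<close> divides another \<open>f\<^sub>Y\<close> (\<open>f_exp_antichain\<close>), so the
  generating set is minimal.

  The algebraic part rests on the primality of ideals generated by indeterminates
  (\<open>primeideal_var_ideal\<close>). It is proved by leading terms: two finite nonempty sets of exponent
  vectors always have a sum that is attained only once (\<open>unique_sum\<close>).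
\<close>

section \<open>Ideals described by a condition on monomials\<close>

definition monomial_ideal ::
    "'v set \<Rightarrow> (('v \<Rightarrow>\<^sub>0 nat) \<Rightarrow> bool) \<Rightarrow> ('v, 'k::field) mpoly set" where
  "monomial_ideal V Q = {p \<in> carrier (poly_ring V). \<forall>m\<in>Poly_Mapping.keys p. Q m}"

lemma ideal_monomial_ideal:
  assumes up: "\<And>m n. Q m \<Longrightarrow> Q (m + n)"
  shows "ideal (monomial_ideal V Q :: ('v, 'k::field) mpoly set) (poly_ring V)"
proof -
  interpret cring "poly_ring V :: ('v, 'k) mpoly ring" by (rule cring_poly_ring)
  let ?I = "monomial_ideal V Q :: ('v, 'k) mpoly set"
  have mult: "a * x \<in> ?I" if a: "a \<in> ?I" and x: "x \<in> carrier (poly_ring V)"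
    for a x :: "('v, 'k) mpoly"
  proof -
    have "a * x \<in> carrier (poly_ring V)"
      using m_closed[of a x] a x by (simp add: monomial_ideal_def)
    moreover have "Q n" if "n \<in> Poly_Mapping.keys (a * x)" for n
    proof -
      from that obtain b c where "b \<in> Poly_Mapping.keys a" "n = b + c"
        using Poly_Mapping.keys_mult[of a x] by blast
      with a up show ?thesis by (auto simp: monomial_ideal_def)
    qed
    ultimately show ?thesis unfolding monomial_ideal_def by blast
  qed
  show ?thesis
  proof (rule idealI)
    show "subgroup ?I (add_monoid (poly_ring V))"
    proof (rule add.subgroupI)
      show "?I \<subseteq> carrier (poly_ring V)" by (auto simp: monomial_ideal_def)
      have "0 \<in> ?I" by (simp add: monomial_ideal_def)
      then show "?I \<noteq> {}" by blast
    next
      fix a assume a: "a \<in> ?I"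
      have "(-1 :: ('v, 'k) mpoly) \<in> carrier (poly_ring V)"
        by (auto simp: keys_minus simp flip: single_one)
      from mult[OF a this] have na: "- a \<in> ?I" by simp
      have "\<ominus>\<^bsub>poly_ring V\<^esub> a = - a"
        using a na by (intro minus_equality) (auto simp: monomial_ideal_def)
      with na show "\<ominus>\<^bsub>poly_ring V\<^esub> a \<in> ?I" by simp
    next
      fix a b assume ab: "a \<in> ?I" "b \<in> ?I"
      then have "a + b \<in> carrier (poly_ring V)"
        using a_closed[of a b] by (simp add: monomial_ideal_def)
      with ab Poly_Mapping.keys_add[of a b] show "a \<oplus>\<^bsub>poly_ring V\<^esub> b \<in> ?I"
        unfolding monomial_ideal_def poly_ring_sel by blast
    qed
  next
    fix a x :: "('v, 'k) mpoly" assume *: "a \<in> ?I" "x \<in> carrier (poly_ring V)"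
    show "a \<otimes>\<^bsub>poly_ring V\<^esub> x \<in> ?I" using mult[OF *] by simp
    show "x \<otimes>\<^bsub>poly_ring V\<^esub> a \<in> ?I" using mult[OF *] by (simp add: mult.commute)
  qed (rule ring_axioms)
qed

lemma single_in_monomial_ideal [simp]:
  "Poly_Mapping.single m (1::'k::field) \<in> monomial_ideal V Q \<longleftrightarrow>
     Poly_Mapping.keys m \<subseteq> V \<and> Q m"
  by (simp add: monomial_ideal_def)

lemma mem_ideal_if_monomials_mem:
  fixes p :: "('v, 'k::field) mpoly"
  assumes J: "ideal J (poly_ring V)"
    and p: "p \<in> carrier (poly_ring V)"
    and m: "\<And>m. m \<in> Poly_Mapping.keys p \<Longrightarrow> Poly_Mapping.single m 1 \<in> J"
  shows "p \<in> J"
proof -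
  interpret ideal J "poly_ring V" by (rule J)
  have "(\<Sum>m\<in>K. Poly_Mapping.single m (Poly_Mapping.lookup p m)) \<in> J"
    if "finite K" "K \<subseteq> Poly_Mapping.keys p" for K
    using that
  proof (induction K)
    case empty
    then show ?case using additive_subgroup.zero_closed[OF ideal.axioms(1)[OF J]] by simp
  next
    case (insert n K)
    have "Poly_Mapping.single 0 (Poly_Mapping.lookup p n) \<in> carrier (poly_ring V)" by auto
    from I_l_closed[OF m[of n] this] insert.prems
    have "Poly_Mapping.single n (Poly_Mapping.lookup p n) \<in> J" by (simp add: mult_single)
    from additive_subgroup.a_closed[OF ideal.axioms(1)[OF J] this insert.IH] insert
    show ?case by simp
  qed
  moreover have "p = (\<Sum>m\<in>Poly_Mapping.keys p. Poly_Mapping.single m (Poly_Mapping.lookup p m))"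
    by (rule poly_mapping_eqI)
       (auto simp: lookup_sum lookup_single when_def sum.delta in_keys_iff)
  ultimately show ?thesis by (metis finite_keys order_refl)
qed


section \<open>Ideals generated by indeterminates\<close>

definition deg_on :: "'v set \<Rightarrow> ('v \<Rightarrow>\<^sub>0 nat) \<Rightarrow> nat" where
  "deg_on C m = (\<Sum>v\<in>C. Poly_Mapping.lookup m v)"

lemma deg_on_add: "deg_on C (m + n) = deg_on C m + deg_on C n"
  by (simp add: deg_on_def lookup_add sum.distrib)

text \<open>For finite \<open>C \<subseteq> V\<close>, the monomials of degree at least one in \<open>C\<close> are those divisible by
  an indeterminate from \<open>C\<close>, so this is the ideal generated by these indeterminates.\<close>

definition var_ideal :: "'v set \<Rightarrow> 'v set \<Rightarrow> ('v, 'k::field) mpoly set" where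
  "var_ideal V C = monomial_ideal V (\<lambda>m. 1 \<le> deg_on C m)"

lemma ideal_deg_on: "ideal (monomial_ideal V (\<lambda>m. d \<le> deg_on C m)) (poly_ring V)"
  by (rule ideal_monomial_ideal) (simp add: deg_on_add)

lemma ideal_var_ideal: "ideal (var_ideal V C) (poly_ring V)"
  unfolding var_ideal_def by (rule ideal_deg_on)

lemma deg_on_split_indet:
  assumes "1 \<le> deg_on C m"
  obtains v n where "v \<in> C" "m = Poly_Mapping.single v 1 + n"
proof -
  from assms obtain v where v: "v \<in> C" "Poly_Mapping.lookup m v \<noteq> 0"
    unfolding deg_on_def by (metis not_one_le_zero sum.neutral)
  have "m = Poly_Mapping.single v 1 + (m - Poly_Mapping.single v 1)"
    using v(2) by (intro poly_mapping_eqI) (auto simp: lookup_add lookup_minus lookup_single when_def)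
  with v(1) show thesis by (rule that)
qed

lemma keys_add_nat:
  "Poly_Mapping.keys (m + n) = Poly_Mapping.keys m \<union> Poly_Mapping.keys (n :: 'v \<Rightarrow>\<^sub>0 nat)"
  by (auto simp: in_keys_iff lookup_add)

lemma deg_on_single_le: "deg_on C (Poly_Mapping.single v 1) \<le> 1"
proof (cases "finite C")
  case True
  then show ?thesis by (simp add: deg_on_def lookup_single when_def)
qed (simp add: deg_on_def)

lemma monomial_mem_ideal:
  fixes P :: "('v, 'k::field) mpoly set"
  assumes P: "ideal P (poly_ring V)" "\<And>v. v \<in> C \<Longrightarrow> indet v \<in> P"
    and m: "Poly_Mapping.keys m \<subseteq> V" "1 \<le> deg_on C m"
  shows "Poly_Mapping.single m 1 \<in> P"
proof -
  interpret ideal P "poly_ring V" by (rule P)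
  obtain v n where v: "v \<in> C" "m = Poly_Mapping.single v 1 + n"
    using deg_on_split_indet[OF m(2)] .
  have "Poly_Mapping.single n (1::'k) \<in> carrier (poly_ring V)"
    using m(1) v(2) by (simp add: keys_add_nat)
  from I_r_closed[OF P(2)[OF v(1)] this] show ?thesis
    by (simp add: indet_def mult_single v(2))
qed

lemma monomial_mem_ideal_square:
  fixes P :: "('v, 'k::field) mpoly set"
  assumes P: "ideal P (poly_ring V)" "\<And>v. v \<in> C \<Longrightarrow> indet v \<in> P"
    and m: "Poly_Mapping.keys m \<subseteq> V" "2 \<le> deg_on C m"
  shows "Poly_Mapping.single m 1 \<in> P \<cdot>\<^bsub>poly_ring V\<^esub> P"
proof -
  have "1 \<le> deg_on C m" using m(2) by simp
  then obtain v n where v: "v \<in> C" "m = Poly_Mapping.single v 1 + n"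
    by (rule deg_on_split_indet)
  have "1 \<le> deg_on C n"
    using m(2) deg_on_single_le[of C v] unfolding v(2) deg_on_add by linarith
  then have "Poly_Mapping.single n 1 \<in> P"
    using m(1) v(2) by (intro monomial_mem_ideal[OF P]) (auto simp: keys_add_nat)
  from ideal_prod.prod[OF P(2)[OF v(1)] this, of "poly_ring V"] show ?thesis
    by (simp add: indet_def mult_single v(2))
qed

lemma ideals_set_square:
  assumes "cring R" "ideal P R"
  shows "P [^]\<^bsub>ideals_set R\<^esub> (2::nat) = P \<cdot>\<^bsub>R\<^esub> P"
proof -
  interpret cring R by (rule assms)
  have "carrier R \<cdot>\<^bsub>R\<^esub> P = P"
    using ideal_prod_one[OF assms(2)] ideal_prod_commute[OF oneideal assms(2)] by simp
  then show ?thesis by (simp add: ideals_set_def numeral_2_eq_2)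
qed

lemma var_ideal_square_subset:
  "(var_ideal V C :: ('v, 'k::field) mpoly set) \<cdot>\<^bsub>poly_ring V\<^esub> var_ideal V C
     \<subseteq> monomial_ideal V (\<lambda>m. 2 \<le> deg_on C m)"
proof
  interpret I: ideal "monomial_ideal V (\<lambda>m. 2 \<le> deg_on C m) :: ('v, 'k) mpoly set" "poly_ring V"
    by (rule ideal_deg_on)
  fix p :: "('v, 'k) mpoly"
  assume "p \<in> var_ideal V C \<cdot>\<^bsub>poly_ring V\<^esub> var_ideal V C"
  then show "p \<in> monomial_ideal V (\<lambda>m. 2 \<le> deg_on C m)"
  proof induction
    case (prod a b)
    then have "a * b \<in> carrier (poly_ring V)"
      using I.m_closed[of a b] by (simp add: var_ideal_def monomial_ideal_def)
    moreover have "2 \<le> deg_on C m" if "m \<in> Poly_Mapping.keys (a * b)" for m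
    proof -
      from that obtain k l where "k \<in> Poly_Mapping.keys a" "l \<in> Poly_Mapping.keys b" "m = k + l"
        using Poly_Mapping.keys_mult[of a b] by blast
      with prod show ?thesis by (fastforce simp: deg_on_add var_ideal_def monomial_ideal_def)
    qed
    ultimately show ?case by (simp add: monomial_ideal_def)
  next
    case (sum a b)
    then show ?case using additive_subgroup.a_closed[OF I.additive_subgroup_axioms] by simp
  qed
qed

text \<open>Maximising one exponent after the other, independently in \<open>S\<close> and in \<open>T\<close>, singles out
  a pair whose sum determines both summands: this is the pair of leading terms for a
  lexicographic order, but no order on the indeterminates has to be chosen. The set \<open>W\<close>, on which
  the summands are to agree, grows by one indeterminate in each step; the sets \<open>S\<close> and \<open>T\<close> vary in
  the induction because the hypothesis is applied to the maximisers.\<close>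

lemma unique_sum_on:
  fixes S T :: "('v \<Rightarrow>\<^sub>0 nat) set"
  assumes "finite W" "finite S" "S \<noteq> {}" "finite T" "T \<noteq> {}"
  shows "\<exists>s\<in>S. \<exists>t\<in>T. \<forall>s'\<in>S. \<forall>t'\<in>T. s' + t' = s + t \<longrightarrow>
           (\<forall>v\<in>W. Poly_Mapping.lookup s' v = Poly_Mapping.lookup s v)"
  using assms
proof (induction W arbitrary: S T)
  case empty
  then show ?case by auto
next
  case (insert v W)
  define a where "a = Max ((\<lambda>s. Poly_Mapping.lookup s v) ` S)"
  define b where "b = Max ((\<lambda>t. Poly_Mapping.lookup t v) ` T)"
  define S' where "S' = {s \<in> S. Poly_Mapping.lookup s v = a}"
  define T' where "T' = {t \<in> T. Poly_Mapping.lookup t v = b}"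
  have a: "Poly_Mapping.lookup s v \<le> a" if "s \<in> S" for s
    unfolding a_def using insert.prems that by simp
  have b: "Poly_Mapping.lookup t v \<le> b" if "t \<in> T" for t
    unfolding b_def using insert.prems that by simp
  have "a \<in> (\<lambda>s. Poly_Mapping.lookup s v) ` S" "b \<in> (\<lambda>t. Poly_Mapping.lookup t v) ` T"
    unfolding a_def b_def using insert.prems by (intro Max_in; simp)+
  then have "S' \<noteq> {}" "T' \<noteq> {}" by (auto simp: S'_def T'_def)
  moreover have "finite S'" "finite T'" using insert.prems by (simp_all add: S'_def T'_def)
  ultimately obtain s t where st: "s \<in> S'" "t \<in> T'"
    and uniq: "\<And>s' t'. \<lbrakk>s' \<in> S'; t' \<in> T'; s' + t' = s + t\<rbrakk> \<Longrightarrow>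
      \<forall>v\<in>W. Poly_Mapping.lookup s' v = Poly_Mapping.lookup s v"
    using insert.IH[of S' T'] by blast
  have "\<forall>u\<in>insert v W. Poly_Mapping.lookup s' u = Poly_Mapping.lookup s u"
    if "s' \<in> S" "t' \<in> T" "s' + t' = s + t" for s' t'
  proof -
    have "Poly_Mapping.lookup s' v + Poly_Mapping.lookup t' v = a + b"
      using st arg_cong[OF that(3), of "\<lambda>m. Poly_Mapping.lookup m v"]
      by (simp add: lookup_add S'_def T'_def)
    with a[OF that(1)] b[OF that(2)]
    have "Poly_Mapping.lookup s' v = a" "Poly_Mapping.lookup t' v = b" by simp_all
    moreover from this have "s' \<in> S'" "t' \<in> T'" using that by (simp_all add: S'_def T'_def)
    ultimately show ?thesis using uniq[OF _ _ that(3)] st by (auto simp: S'_def)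
  qed
  with st show ?case unfolding S'_def T'_def by blast
qed

lemma unique_sum:
  fixes S T :: "('v \<Rightarrow>\<^sub>0 nat) set"
  assumes "finite S" "S \<noteq> {}" "finite T" "T \<noteq> {}"
  obtains s t where "s \<in> S" "t \<in> T"
    "\<And>s' t'. \<lbrakk>s' \<in> S; t' \<in> T; s' + t' = s + t\<rbrakk> \<Longrightarrow> s' = s"
proof -
  define W where "W = (\<Union>s\<in>S. Poly_Mapping.keys s)"
  have "finite W" using assms(1) by (simp add: W_def)
  from unique_sum_on[OF this assms] obtain s t where st: "s \<in> S" "t \<in> T"
    and u: "\<And>s' t'. \<lbrakk>s' \<in> S; t' \<in> T; s' + t' = s + t\<rbrakk> \<Longrightarrow>
      \<forall>v\<in>W. Poly_Mapping.lookup s' v = Poly_Mapping.lookup s v"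
    by blast
  have "s' = s" if "s' \<in> S" "t' \<in> T" "s' + t' = s + t" for s' t'
  proof (rule poly_mapping_eqI)
    fix v
    show "Poly_Mapping.lookup s' v = Poly_Mapping.lookup s v"
    proof (cases "v \<in> W")
      case False
      then have "v \<notin> Poly_Mapping.keys s'" "v \<notin> Poly_Mapping.keys s"
        using that(1) st(1) by (auto simp: W_def)
      then show ?thesis by (simp add: in_keys_iff)
    qed (use u[OF that] in blast)
  qed
  with st show thesis by (rule that)
qed

lemma lookup_mult_unique_sum:
  fixes p r :: "('v, 'k::field) mpoly"
  assumes "\<And>a b. \<lbrakk>a \<in> Poly_Mapping.keys p; b \<in> Poly_Mapping.keys r; a + b = s + t\<rbrakk> \<Longrightarrow> a = s"
  shows "Poly_Mapping.lookup (p * r) (s + t) = Poly_Mapping.lookup p s * Poly_Mapping.lookup r t"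
proof -
  have "Poly_Mapping.lookup p a * (\<Sum>b. Poly_Mapping.lookup r b when s + t = a + b) =
        (Poly_Mapping.lookup p s * Poly_Mapping.lookup r t when a = s)" for a
  proof (cases "a = s")
    case True
    then show ?thesis by (simp add: when_def)
  next
    case False
    have "(Poly_Mapping.lookup r b when s + t = a + b) = 0" if "a \<in> Poly_Mapping.keys p" for b
    proof (cases "b \<in> Poly_Mapping.keys r")
      case True
      with assms[OF that True] False show ?thesis by (metis when_neq_zero zero_when when_def)
    qed (simp add: in_keys_iff)
    then show ?thesis using False by (cases "a \<in> Poly_Mapping.keys p") (simp_all add: in_keys_iff)
  qed
  then show ?thesis by (simp add: lookup_mult)
qed

text \<open>A polynomial over \<open>V\<close> lies outside \<open>var_ideal V C\<close> iff it has a monomial in which no element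
  of \<open>C\<close> occurs. Among such monomials of two factors there is a pair whose product is
  not reached by any other pair from them, nor by a pair involving \<open>C\<close>, since it avoids \<open>C\<close> itself.
  So it survives in the product of the two polynomials.\<close>

lemma primeideal_var_ideal:
  assumes "finite C"
  shows "primeideal (var_ideal V C :: ('v, 'k::field) mpoly set) (poly_ring V)"
proof (rule primeidealI[OF ideal_var_ideal cring_poly_ring])
  have "(1 :: ('v, 'k) mpoly) \<notin> var_ideal V C"
    by (simp add: var_ideal_def monomial_ideal_def deg_on_def)
  moreover have "(1 :: ('v, 'k) mpoly) \<in> carrier (poly_ring V)" by simp
  ultimately show "carrier (poly_ring V) \<noteq> (var_ideal V C :: ('v, 'k) mpoly set)" by blast
next
  fix p r :: "('v, 'k) mpoly"
  assume carr: "p \<in> carrier (poly_ring V)" "r \<in> carrier (poly_ring V)"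
    and pr: "p \<otimes>\<^bsub>poly_ring V\<^esub> r \<in> var_ideal V C"
  show "p \<in> var_ideal V C \<or> r \<in> var_ideal V C"
  proof (rule ccontr)
    assume neither: "\<not> ?thesis"
    define S where "S = {m \<in> Poly_Mapping.keys p. deg_on C m = 0}"
    define T where "T = {m \<in> Poly_Mapping.keys r. deg_on C m = 0}"
    have "S \<noteq> {}" "T \<noteq> {}"
      using neither carr unfolding S_def T_def var_ideal_def monomial_ideal_def
      by (fastforce simp: not_less_eq_eq)+
    moreover have "finite S" "finite T" by (simp_all add: S_def T_def)
    ultimately obtain s t where st: "s \<in> S" "t \<in> T"
      and u: "\<And>s' t'. \<lbrakk>s' \<in> S; t' \<in> T; s' + t' = s + t\<rbrakk> \<Longrightarrow> s' = s"
      using unique_sum[of S T] by metis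
    have deg: "deg_on C (s + t) = 0" using st by (simp add: S_def T_def deg_on_add)
    have "Poly_Mapping.lookup (p * r) (s + t) = Poly_Mapping.lookup p s * Poly_Mapping.lookup r t"
    proof (rule lookup_mult_unique_sum)
      fix a b assume ab: "a \<in> Poly_Mapping.keys p" "b \<in> Poly_Mapping.keys r" "a + b = s + t"
      then have "deg_on C a + deg_on C b = 0" using deg by (metis deg_on_add)
      then show "a = s" using ab u[of a b] by (simp add: S_def T_def)
    qed
    moreover have "Poly_Mapping.lookup p s \<noteq> 0" "Poly_Mapping.lookup r t \<noteq> 0"
      using st by (simp_all add: S_def T_def in_keys_iff)
    ultimately have "s + t \<in> Poly_Mapping.keys (p * r)" by (simp add: in_keys_iff)
    then show False using pr deg by (auto simp: var_ideal_def monomial_ideal_def)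
  qed
qed


section \<open>The symbolic square of the extremal ideal\<close>

definition is_cover :: "nat \<Rightarrow> nat set set \<Rightarrow> bool" where
  "is_cover q C \<longleftrightarrow> C \<subseteq> ext_vars q \<and> {1..q} \<subseteq> \<Union>C"

lemma finite_ext_vars: "finite (ext_vars q)"
  unfolding ext_vars_def by (rule finite_subset[of _ "Pow {1..q}"]) auto

lemma finite_cover: "is_cover q C \<Longrightarrow> finite C"
  unfolding is_cover_def using finite_ext_vars finite_subset by blast

lemma prod_indet:
  assumes "finite S"
  shows "(\<Prod>v\<in>S. indet v ^ d) =
    Poly_Mapping.single (\<Sum>v\<in>S. Poly_Mapping.single v d) (1::'k::field)"
proof -
  have "indet v ^ d = Poly_Mapping.single (Poly_Mapping.single v d) (1::'k)" for v :: 'a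
    by (induction d) (simp_all add: indet_def mult_single flip: single_add)
  with assms show ?thesis by (induction S) (simp_all add: mult_single)
qed

lemma lookup_sum_single:
  assumes "finite S"
  shows "Poly_Mapping.lookup (\<Sum>v\<in>S. Poly_Mapping.single v d) u = (d when u \<in> S)"
  using assms by (simp add: lookup_sum lookup_single when_def)

lemma keys_sum_single:
  assumes "finite S"
  shows "Poly_Mapping.keys (\<Sum>v\<in>S. Poly_Mapping.single v d) \<subseteq> S"
proof
  fix u assume "u \<in> Poly_Mapping.keys (\<Sum>v\<in>S. Poly_Mapping.single v d)"
  then show "u \<in> S"
    unfolding in_keys_iff lookup_sum_single[OF assms] by (simp add: when_def split: if_splits)
qed

lemma extremal_ideal_subset_var_ideal:
  assumes C: "is_cover q C"
  shows "(extremal_ideal q :: (nat set, 'k::field) mpoly set) \<subseteq> var_ideal (ext_vars q) C"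
proof -
  interpret cring "poly_ring (ext_vars q) :: (nat set, 'k) mpoly ring" by (rule cring_poly_ring)
  have "ext_gen q i \<in> (var_ideal (ext_vars q) C :: (nat set, 'k) mpoly set)" if i: "i \<in> {1..q}" for i
  proof -
    let ?S = "{A \<in> ext_vars q. i \<in> A}"
    let ?e = "\<Sum>A\<in>?S. Poly_Mapping.single A (1::nat)"
    have fin: "finite ?S" using finite_ext_vars by simp
    obtain A where A: "A \<in> C" "i \<in> A" "A \<in> ext_vars q"
      using C i unfolding is_cover_def by blast
    then have "1 \<le> Poly_Mapping.lookup ?e A" by (simp add: lookup_sum_single fin)
    also have "\<dots> \<le> deg_on C ?e"
      unfolding deg_on_def using A finite_cover[OF C] by (intro member_le_sum) auto
    finally have "1 \<le> deg_on C ?e" .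
    moreover have "Poly_Mapping.keys ?e \<subseteq> ext_vars q"
      using keys_sum_single[OF fin] by blast
    ultimately show ?thesis
      using prod_indet[OF fin, of 1, where 'k = 'k]
      by (simp add: ext_gen_def var_ideal_def)
  qed
  then show ?thesis unfolding extremal_ideal_def ext_ring_def
    by (intro genideal_minimal ideal_var_ideal) auto
qed

lemma primeideal_prod_indet:
  fixes P :: "('v, 'k::field) mpoly set"
  assumes "primeideal P (poly_ring V)" "finite S" "S \<subseteq> V" "(\<Prod>v\<in>S. indet v) \<in> P"
  shows "\<exists>v\<in>S. indet v \<in> P"
proof -
  interpret primeideal P "poly_ring V" by (rule assms)
  have V: "indet v \<in> carrier (poly_ring V)" if "v \<in> V" for v using that by (simp add: indet_def)
  have carr: "(\<Prod>v\<in>F. indet v) \<in> carrier (poly_ring V :: ('v, 'k) mpoly ring)"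
    if "finite F" "F \<subseteq> V" for F
    using that
  proof (induction F)
    case (insert v F)
    then have "indet v \<otimes>\<^bsub>poly_ring V\<^esub> (\<Prod>v\<in>F. indet v) \<in> carrier (poly_ring V :: ('v, 'k) mpoly ring)"
      by (intro m_closed V) auto
    with insert.hyps show ?case by simp
  qed simp
  show ?thesis using assms(2-4)
  proof (induction S)
    case empty
    then show ?case using one_imp_carrier I_notcarr by simp
  next
    case (insert v F)
    then have "indet v \<in> P \<or> (\<Prod>v\<in>F. indet v) \<in> P"
      using V carr[of F] by (intro I_prime) auto
    with insert show ?case by auto
  qed
qed

lemma cover_of_prime:
  fixes P :: "(nat set, 'k::field) mpoly set"
  assumes P: "primeideal P (poly_ring (ext_vars q))" "extremal_ideal q \<subseteq> P"
  shows "is_cover q {A \<in> ext_vars q. indet A \<in> P}"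
proof -
  interpret primeideal P "poly_ring (ext_vars q)" by (rule P)
  have "i \<in> \<Union>{A \<in> ext_vars q. indet A \<in> P}" if i: "i \<in> {1..q}" for i
  proof -
    have fin: "finite {A \<in> ext_vars q. i \<in> A}" for i using finite_ext_vars by simp
    have "ext_gen q ` {1..q} \<subseteq> carrier (poly_ring (ext_vars q) :: (nat set, 'k) mpoly ring)"
    proof
      fix g :: "(nat set, 'k) mpoly" assume "g \<in> ext_gen q ` {1..q}"
      then obtain j where "g = ext_gen q j" by blast
      then show "g \<in> carrier (poly_ring (ext_vars q))"
        using prod_indet[OF fin, of 1 j, where 'k = 'k]
          subset_trans[OF keys_sum_single[OF fin, of "Suc 0" j] Collect_restrict]
        by (simp add: ext_gen_def)
    qed
    from genideal_self[OF this] i have "ext_gen q i \<in> (extremal_ideal q :: (nat set, 'k) mpoly set)"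
      unfolding extremal_ideal_def ext_ring_def by blast
    with P(2) have "(\<Prod>A\<in>{A \<in> ext_vars q. i \<in> A}. indet A) \<in> P" by (auto simp: ext_gen_def)
    from primeideal_prod_indet[OF P(1) fin _ this] show ?thesis by blast
  qed
  then show ?thesis unfolding is_cover_def by blast
qed

text \<open>The indeterminates in a smaller prime \<open>Q\<close> form a cover inside \<open>C\<close>, hence all of \<open>C\<close>,
  and they generate \<open>var_ideal (ext_vars q) C\<close>.\<close>

lemma var_ideal_minimal_prime:
  assumes C: "is_cover q C" and min: "\<And>D. \<lbrakk>is_cover q D; D \<subseteq> C\<rbrakk> \<Longrightarrow> D = C"
  shows "(var_ideal (ext_vars q) C :: (nat set, 'k::field) mpoly set)
           \<in> minimal_primes (ext_ring q) (extremal_ideal q)"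
proof -
  have "Q = var_ideal (ext_vars q) C"
    if Q: "primeideal Q (poly_ring (ext_vars q))" "extremal_ideal q \<subseteq> Q"
      "Q \<subseteq> var_ideal (ext_vars q) C" for Q :: "(nat set, 'k) mpoly set"
  proof -
    have "{A \<in> ext_vars q. indet A \<in> Q} \<subseteq> C"
    proof
      fix A assume "A \<in> {A \<in> ext_vars q. indet A \<in> Q}"
      then have "indet A \<in> (var_ideal (ext_vars q) C :: (nat set, 'k) mpoly set)" using Q(3) by blast
      then have "1 \<le> deg_on C (Poly_Mapping.single A 1)"
        by (simp add: indet_def var_ideal_def)
      then show "A \<in> C"
        using finite_cover[OF C] by (auto simp: deg_on_def lookup_single when_def split: if_splits)
    qed
    from min[OF cover_of_prime[OF Q(1,2)] this]
    have indet: "indet A \<in> Q" if "A \<in> C" for A using that by blast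
    have "var_ideal (ext_vars q) C \<subseteq> Q"
    proof
      fix p :: "(nat set, 'k) mpoly" assume p: "p \<in> var_ideal (ext_vars q) C"
      have QI: "ideal Q (poly_ring (ext_vars q))" using Q(1) by (rule primeideal.axioms(1))
      show "p \<in> Q"
        by (rule mem_ideal_if_monomials_mem[OF QI])
           (use p in \<open>auto simp: var_ideal_def monomial_ideal_def
              intro!: monomial_mem_ideal[OF QI indet]\<close>)
    qed
    with Q(3) show ?thesis by blast
  qed
  then show ?thesis
    using primeideal_var_ideal[OF finite_cover[OF C], of "ext_vars q", where 'k = 'k]
      extremal_ideal_subset_var_ideal[OF C, where 'k = 'k]
    unfolding minimal_primes_def ext_ring_def by blast
qed

lemma obtain_minimal_cover:
  assumes "is_cover q C"
  obtains D where "is_cover q D" "D \<subseteq> C" "\<And>E. \<lbrakk>is_cover q E; E \<subseteq> D\<rbrakk> \<Longrightarrow> E = D"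
proof -
  let ?F = "{D. is_cover q D \<and> D \<subseteq> C}"
  have "finite ?F"
    by (rule finite_subset[of _ "Pow C"]) (use finite_cover[OF assms] in auto)
  moreover have "C \<in> ?F" using assms by simp
  ultimately obtain D where D: "D \<in> ?F" "\<And>E. E \<in> ?F \<Longrightarrow> E \<le> D \<Longrightarrow> D = E"
    using finite_has_minimal2[of ?F C] by (metis (lifting))
  show thesis
  proof (rule that[of D])
    show "E = D" if "is_cover q E" "E \<subseteq> D" for E
      using D(1) D(2)[of E] that by blast
  qed (use D(1) in auto)
qed

text \<open>Each minimal cover gives a minimal prime, whose square imposes the degree condition;
  the condition for any other cover follows by passing to a minimal cover inside it. Conversely,
  the degree condition for the cover read off from a minimal prime \<open>P\<close> puts a monomial
  into \<open>P \<cdot> P\<close>.\<close>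

lemma symbolic_square_extremal_ideal:
  "symbolic_power (ext_ring q) (extremal_ideal q :: (nat set, 'k::field) mpoly set) 2 =
     monomial_ideal (ext_vars q) (\<lambda>m. \<forall>C. is_cover q C \<longrightarrow> 2 \<le> deg_on C m)"
proof -
  let ?V = "ext_vars q"
  let ?R = "poly_ring ?V :: (nat set, 'k) mpoly ring"
  let ?E = "extremal_ideal q :: (nat set, 'k) mpoly set"
  interpret cring ?R by (rule cring_poly_ring)
  have "p \<in> monomial_ideal ?V (\<lambda>m. \<forall>C. is_cover q C \<longrightarrow> 2 \<le> deg_on C m)"
    if p: "p \<in> symbolic_power (ext_ring q) ?E 2" for p
  proof -
    have "2 \<le> deg_on C m" if m: "m \<in> Poly_Mapping.keys p" and C: "is_cover q C" for m C
    proof -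
      obtain D where D: "is_cover q D" "D \<subseteq> C" "\<And>E. \<lbrakk>is_cover q E; E \<subseteq> D\<rbrakk> \<Longrightarrow> E = D"
        using obtain_minimal_cover[OF C] by blast
      from p var_ideal_minimal_prime[OF D(1,3), where 'k = 'k]
      have "p \<in> var_ideal ?V D [^]\<^bsub>ideals_set ?R\<^esub> (2::nat)"
        unfolding symbolic_power_def ext_ring_def by blast
      then have "p \<in> monomial_ideal ?V (\<lambda>m. 2 \<le> deg_on D m)"
        using var_ideal_square_subset ideals_set_square[OF cring_poly_ring ideal_var_ideal] by blast
      then have "2 \<le> deg_on D m" using m by (simp add: monomial_ideal_def)
      also have "\<dots> \<le> deg_on C m"
        unfolding deg_on_def using D(2) finite_cover[OF C] by (intro sum_mono2) auto
      finally show ?thesis .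
    qed
    moreover have "p \<in> carrier ?R" using p by (simp add: symbolic_power_def ext_ring_def)
    ultimately show ?thesis by (simp add: monomial_ideal_def)
  qed
  moreover have "p \<in> symbolic_power (ext_ring q) ?E 2"
    if p: "p \<in> monomial_ideal ?V (\<lambda>m. \<forall>C. is_cover q C \<longrightarrow> 2 \<le> deg_on C m)" for p
  proof -
    have carr: "p \<in> carrier ?R" using p by (simp add: monomial_ideal_def)
    have "p \<in> P [^]\<^bsub>ideals_set ?R\<^esub> (2::nat)" if P: "P \<in> minimal_primes ?R ?E" for P
    proof -
      have prime: "primeideal P ?R" and sub: "?E \<subseteq> P" using P by (auto simp: minimal_primes_def)
      have PI: "ideal P ?R" using prime by (rule primeideal.axioms(1))
      have "Poly_Mapping.single m 1 \<in> P \<cdot>\<^bsub>?R\<^esub> P" if m: "m \<in> Poly_Mapping.keys p" for m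
        by (rule monomial_mem_ideal_square[OF PI, of "{A \<in> ?V. indet A \<in> P}"])
           (use p m cover_of_prime[OF prime sub] in \<open>auto simp: monomial_ideal_def\<close>)
      from mem_ideal_if_monomials_mem[OF ideal_prod_is_ideal[OF PI PI] carr this]
      show ?thesis by (simp add: ideals_set_square[OF cring_poly_ring PI])
    qed
    with carr show ?thesis by (simp add: symbolic_power_def ext_ring_def)
  qed
  ultimately show ?thesis by blast
qed


section \<open>The monomials \<open>f\<^sub>X\<close>\<close>

definition f_exp :: "nat \<Rightarrow> nat set \<Rightarrow> nat set \<Rightarrow>\<^sub>0 nat" where
  "f_exp q X =
     (\<Sum>A\<in>{A \<in> ext_vars q. X \<subseteq> A}. Poly_Mapping.single A 2) +
     (\<Sum>A\<in>{A \<in> ext_vars q. X \<inter> A \<noteq> {} \<and> X \<inter> ({1..q} - A) \<noteq> {}}. Poly_Mapping.single A 1)"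

lemma f_gen_eq: "f_gen q X = Poly_Mapping.single (f_exp q X) (1::'k::field)"
proof -
  have fin: "finite {A \<in> ext_vars q. Q A}" for Q using finite_ext_vars by simp
  have "(\<Prod>A\<in>{A \<in> ext_vars q. Q A}. indet A) = Poly_Mapping.single
      (\<Sum>A\<in>{A \<in> ext_vars q. Q A}. Poly_Mapping.single A 1) (1::'k)" for Q
    using prod_indet[OF fin, of 1 Q, where 'k = 'k] by simp
  then show ?thesis
    unfolding f_gen_def f_exp_def prod_indet[OF fin] by (simp add: mult_single)
qed

lemma lookup_f_exp:
  assumes "X \<noteq> {}" "X \<subseteq> {1..q}"
  shows "Poly_Mapping.lookup (f_exp q X) A =
    ((if X \<subseteq> A then 2 else if X \<inter> A \<noteq> {} then 1 else 0) when A \<in> ext_vars q)"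
proof -
  have "X \<inter> ({1..q} - A) \<noteq> {} \<longleftrightarrow> \<not> X \<subseteq> A" using assms by blast
  moreover have "finite {A \<in> ext_vars q. Q A}" for Q using finite_ext_vars by simp
  ultimately show ?thesis using assms(1)
    by (auto simp: f_exp_def lookup_add lookup_sum_single when_def)
qed

lemma keys_f_exp:
  assumes "X \<noteq> {}" "X \<subseteq> {1..q}"
  shows "Poly_Mapping.keys (f_exp q X) \<subseteq> ext_vars q"
  using lookup_f_exp[OF assms] by (auto simp: in_keys_iff when_def split: if_splits)

text \<open>If no member of the cover contains \<open>X\<close>, then \<open>X\<close> takes at least two members to be covered.\<close>

lemma f_exp_deg_on_cover:
  assumes X: "X \<noteq> {}" "X \<subseteq> {1..q}" and C: "is_cover q C"
  shows "2 \<le> deg_on C (f_exp q X)"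
proof -
  have V: "C \<subseteq> ext_vars q" and fin: "finite C"
    using C finite_cover by (auto simp: is_cover_def)
  show ?thesis
  proof (cases "\<exists>A\<in>C. X \<subseteq> A")
    case True
    then obtain A where A: "A \<in> C" "X \<subseteq> A" by blast
    then have "2 \<le> Poly_Mapping.lookup (f_exp q X) A"
      using V by (auto simp: lookup_f_exp[OF X])
    also have "\<dots> \<le> deg_on C (f_exp q X)"
      unfolding deg_on_def using A fin by (intro member_le_sum) auto
    finally show ?thesis .
  next
    case False
    obtain x where x: "x \<in> X" using X by blast
    then obtain A where A: "A \<in> C" "x \<in> A"
      using X C unfolding is_cover_def by blast
    with False obtain y where y: "y \<in> X" "y \<notin> A" by blast
    then obtain B where B: "B \<in> C" "y \<in> B"
      using X C unfolding is_cover_def by blast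
    have "A \<noteq> B" using y B by blast
    then have "2 \<le> (\<Sum>D\<in>{A, B}. Poly_Mapping.lookup (f_exp q X) D)"
      using A B V x y False by (auto simp: lookup_f_exp[OF X] when_def)
    also have "\<dots> \<le> deg_on C (f_exp q X)"
      unfolding deg_on_def using A B fin by (intro sum_mono2) auto
    finally show ?thesis .
  qed
qed

text \<open>The witness \<open>X\<close> consists of the points that lie in \<open>A\<close> for no indeterminate \<open>y\<^sub>A\<close> missing
  from \<open>m\<close>. A set \<open>A \<supseteq> X\<close> completes the indices of these indeterminates to a cover, so by
  the degree condition \<open>y\<^sub>A\<close> has exponent at least 2; and if \<open>y\<^sub>A\<close> does not occur, then \<open>A\<close> is
  disjoint from \<open>X\<close>.\<close>

lemma f_exp_divides:
  assumes m: "\<And>C. is_cover q C \<Longrightarrow> 2 \<le> deg_on C m"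
  obtains X n where "X \<noteq> {}" "X \<subseteq> {1..q}" "m = f_exp q X + n"
proof -
  define Z where "Z = {A \<in> ext_vars q. Poly_Mapping.lookup m A = 0}"
  define X where "X = {1..q} - \<Union>Z"
  have fin: "finite Z" unfolding Z_def using finite_ext_vars by simp
  have Z0: "deg_on Z m = 0" by (simp add: deg_on_def Z_def)
  have "X \<noteq> {}"
  proof
    assume "X = {}"
    then have "is_cover q Z" by (auto simp: is_cover_def X_def Z_def)
    from m[OF this] Z0 show False by simp
  qed
  moreover have X: "X \<subseteq> {1..q}" by (auto simp: X_def)
  moreover have "Poly_Mapping.lookup (f_exp q X) A \<le> Poly_Mapping.lookup m A" for A
  proof -
    have "2 \<le> Poly_Mapping.lookup m A" if "A \<in> ext_vars q" "X \<subseteq> A"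
    proof -
      \<comment> \<open>\<open>A\<close> covers \<open>X\<close>, and \<open>Z\<close> covers the rest of \<open>[q]\<close>\<close>
      have "is_cover q (insert A Z)" using that by (auto simp: is_cover_def X_def Z_def)
      from m[OF this] have "2 \<le> deg_on (insert A Z) m" .
      also have "\<dots> \<le> Poly_Mapping.lookup m A + deg_on Z m"
        unfolding deg_on_def using fin by (simp add: sum.insert_if)
      finally show ?thesis using Z0 by simp
    qed
    moreover have "1 \<le> Poly_Mapping.lookup m A" if "A \<in> ext_vars q" "X \<inter> A \<noteq> {}"
    proof (rule ccontr)
      assume "\<not> ?thesis"
      then have "A \<in> Z" using that by (simp add: Z_def)
      with that(2) show False by (auto simp: X_def)
    qed
    ultimately show ?thesis by (simp add: lookup_f_exp[OF \<open>X \<noteq> {}\<close> X] when_def)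
  qed
  then have "m = f_exp q X + (m - f_exp q X)"
    by (intro poly_mapping_eqI) (simp add: lookup_add lookup_minus)
  ultimately show thesis by (rule that)
qed

text \<open>Compare the exponents of \<open>y\<^bsub>X - Y\<^esub>\<close>, if \<open>X\<close> is not contained in \<open>Y\<close>: it is positive in
  \<open>f\<^sub>X\<close> but 0 in \<open>f\<^sub>Y\<close>. If \<open>X \<subset> Y\<close>, compare those of \<open>y\<^sub>X\<close>: 2 in \<open>f\<^sub>X\<close> but 1 in \<open>f\<^sub>Y\<close>.\<close>

lemma f_exp_antichain:
  assumes X: "X \<noteq> {}" "X \<subseteq> {1..q}" and Y: "Y \<noteq> {}" "Y \<subseteq> {1..q}"
    and eq: "f_exp q Y = f_exp q X + n"
  shows "X = Y"
proof -
  have le: "Poly_Mapping.lookup (f_exp q X) A \<le> Poly_Mapping.lookup (f_exp q Y) A" for A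
    by (simp add: eq lookup_add)
  have "X \<subseteq> Y"
  proof (rule ccontr)
    assume "\<not> X \<subseteq> Y"
    then have "X - Y \<in> ext_vars q" "X \<inter> (X - Y) \<noteq> {}" "Y \<inter> (X - Y) = {}" "\<not> Y \<subseteq> X - Y"
      using X Y by (auto simp: ext_vars_def)
    with le[of "X - Y"] show False
      by (simp add: lookup_f_exp[OF X] lookup_f_exp[OF Y] split: if_splits)
  qed
  moreover have "Y \<subseteq> X"
    using le[of X] X
    by (simp add: lookup_f_exp[OF X] lookup_f_exp[OF Y] ext_vars_def split: if_splits)
  ultimately show ?thesis by blast
qed

theorem theorem5p6:
  fixes q :: nat
  assumes "q \<ge> 1"
  shows "Mingens (ext_vars q)
           (symbolic_power (ext_ring q) (extremal_ideal q :: (nat set, 'k::field) mpoly set) 2) =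
         {f_gen q X |X. X \<noteq> {} \<and> X \<subseteq> {1..q}}"
proof (rule Mingens_eqI)
  let ?R = "poly_ring (ext_vars q) :: (nat set, 'k) mpoly ring"
  let ?G = "{f_gen q X |X. X \<noteq> {} \<and> X \<subseteq> {1..q}} :: (nat set, 'k) mpoly set"
  let ?Q = "\<lambda>m. \<forall>C. is_cover q C \<longrightarrow> 2 \<le> deg_on C m"
  let ?J = "monomial_ideal (ext_vars q) ?Q :: (nat set, 'k) mpoly set"
  interpret cring ?R by (rule cring_poly_ring)
  have mon: "?G \<subseteq> monomials (ext_vars q)"
    using keys_f_exp unfolding f_gen_eq monomials_def by blast
  then have carr: "?G \<subseteq> carrier ?R" using monomials_carrier by (rule subset_trans)
  have J: "ideal ?J ?R" by (rule ideal_monomial_ideal) (auto simp: deg_on_add trans_le_add1)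
  have GJ: "?G \<subseteq> ?J"
  proof
    fix p assume "p \<in> ?G"
    then obtain X where "X \<noteq> {}" "X \<subseteq> {1..q}" "p = f_gen q X" by blast
    then show "p \<in> ?J"
      unfolding f_gen_eq using keys_f_exp f_exp_deg_on_cover by simp
  qed
  interpret I: ideal "Idl\<^bsub>?R\<^esub> ?G" ?R by (rule genideal_ideal[OF carr])
  have "?J \<subseteq> Idl\<^bsub>?R\<^esub> ?G"
  proof
    fix p assume p: "p \<in> ?J"
    show "p \<in> Idl\<^bsub>?R\<^esub> ?G"
    proof (rule mem_ideal_if_monomials_mem[OF I.ideal_axioms])
      show "p \<in> carrier ?R" using p by (simp add: monomial_ideal_def)
      fix m assume m: "m \<in> Poly_Mapping.keys p"
      then obtain X n where X: "X \<noteq> {}" "X \<subseteq> {1..q}" "m = f_exp q X + n"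
        using f_exp_divides[of q m] p by (auto simp: monomial_ideal_def)
      have "f_gen q X \<in> Idl\<^bsub>?R\<^esub> ?G" using X genideal_self[OF carr] by blast
      moreover have "Poly_Mapping.single n (1::'k) \<in> carrier ?R"
      proof -
        have "Poly_Mapping.keys m \<subseteq> ext_vars q" using p m by (simp add: monomial_ideal_def)
        then show ?thesis by (simp add: X(3) keys_add_nat)
      qed
      ultimately have "f_gen q X \<otimes>\<^bsub>?R\<^esub> Poly_Mapping.single n 1 \<in> Idl\<^bsub>?R\<^esub> ?G"
        by (rule I.I_r_closed)
      then show "Poly_Mapping.single m 1 \<in> Idl\<^bsub>?R\<^esub> ?G"
        by (simp add: f_gen_eq mult_single X(3))
    qed
  qed
  with genideal_minimal[OF J GJ] have Idl: "Idl\<^bsub>?R\<^esub> ?G = ?J" by blast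
  have "Idl\<^bsub>?R\<^esub> H \<noteq> ?J" if H: "H \<subset> ?G" for H
  proof
    assume eq: "Idl\<^bsub>?R\<^esub> H = ?J"
    obtain Y where Y: "Y \<noteq> {}" "Y \<subseteq> {1..q}" "f_gen q Y \<notin> H" using H by blast
    have "f_gen q Y \<in> ?G" using Y(1,2) by blast
    from subsetD[OF GJ this] have "Poly_Mapping.single (f_exp q Y) (1::'k) \<in> Idl\<^bsub>?R\<^esub> H"
      unfolding eq f_gen_eq .
    from monomial_in_Idl[OF _ this] H mon
    obtain h n where h: "Poly_Mapping.single h (1::'k) \<in> H" "f_exp q Y = h + n" by blast
    have "Poly_Mapping.single h 1 \<in> ?G" using h(1) H by (rule psubsetD[rotated])
    then obtain X where X: "X \<noteq> {}" "X \<subseteq> {1..q}" "f_gen q X = Poly_Mapping.single h (1::'k)"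
      by force
    then have "h = f_exp q X" by (metis f_gen_eq lookup_single_eq lookup_single_not_eq zero_neq_one)
    with h f_exp_antichain[OF X(1,2) Y(1,2)] X(3) Y(3) show False by metis
  qed
  with mon Idl show "is_Mingens (ext_vars q)
      (symbolic_power (ext_ring q) (extremal_ideal q :: (nat set, 'k) mpoly set) 2) ?G"
    unfolding is_Mingens_def symbolic_square_extremal_ideal by blast
qed

end
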